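(* Let $(\alpha,\beta)\in K^2$. For any planar rooted tree $t$, $$\mathbf{a}_t(\alpha,\beta)=\alpha^{|t|-1}\frac{[t]_\beta!}{t!}.$$ In particular, $\mathbf{a}_t(1,0)=\frac{1}{t!}$, $\mathbf{a}_t(1,1)=1$, and $\mathbf{a}_t(0,\beta)=\delta_{t,\bullet}$ for all $\beta$. Moreover, $\mathbf{a}_t(1,-1)=1$ if $t$ is a ladder, and $\mathbf{a}_t(1,-1)=0$ if $t$ is not a ladder.
   Context: $K$ is a field of characteristic zero, and $0^0=1$. A planar rooted tree is a rooted tree (finite connected graph without cycles, with a distinguished root) with an embedding in the plane; its weight $|t|$ is its number of vertices, and $\bullet$ is the tree of weight $1$. A ladder is a tree in which every vertex has at most one child. The fertility of a vertex is its number of children. $\mathcal{H}_{NCK}$ is the free associative unital $K$-algebra generated by planar rooted trees, graded by weight; its completion is the product of its homogeneous components. $B^+$ sends a planar forest $t_1\cdots t_k$ to the planar tree obtained by grafting $t_1,\ldots,t_k$, in this order, on a common new root ($B^+(1)=\bullet$), extended linearly and continuously. For $(\alpha,\beta)\in K^2$, $P_{\alpha,\beta}(h)=\sum_{n\ge0}p_n(\alpha,\beta)h^n\in K[[h]]$ is the unique solution of $(1-\alpha\beta h)P'(h)=\alpha P(h)$, $P(0)=1$. $\mathbf{X}_{P_{\alpha,\beta}}=\sum_{n\ge1}\mathbf{a}_n(\alpha,\beta)\in\overline{\mathcal{H}_{NCK}}$, with $\mathbf{a}_n(\alpha,\beta)$ homogeneous of degree $n$, is the unique solution of $X=B^+(P_{\alpha,\beta}(X))$,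 i.e. $\mathbf{a}_1=\bullet$ and $\mathbf{a}_{n+1}=\sum_{k=1}^n\sum_{\alpha_1+\cdots+\alpha_k=n,\ \alpha_i\geq 1}p_k(\alpha,\beta)B^+(\mathbf{a}_{\alpha_1}\cdots\mathbf{a}_{\alpha_k})$. Each $\mathbf{a}_n(\alpha,\beta)$ is a linear combination of planar trees of weight $n$, and one writes $\mathbf{a}_n(\alpha,\beta)=\sum_{|t|=n}\mathbf{a}_t(\alpha,\beta)\,t$ with $\mathbf{a}_t(\alpha,\beta)\in K$. For $i\ge1$, $[i]_\beta=1+\beta(i-1)$; $[i]_\beta!=[1]_\beta\cdots[i]_\beta$ and $[0]_\beta!=1$. For a tree $t$, $t!=\prod_{s}(\text{fertility of }s)!$ and $[t]_\beta!=\prod_{s}[\text{fertility of }s]_\beta!$, the products being over all vertices $s$ of $t$. *)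

theory Defs
  imports
    "HOL-Computational_Algebra.Formal_Power_Series"
    "HOL-Library.Groups_Big_Fun"
begin

section \<open>Planar rooted trees and forests\<close>

datatype ptree = Node (children: "ptree list")

type_synonym pforest = "ptree list"

abbreviation single_vertex :: ptree  ("\<bullet>\<^sub>T") where
  "\<bullet>\<^sub>T \<equiv> Node []"

text \<open>A vertex is represented by the subtree hanging below it; distinct vertices may carry equal
  subtrees, so the vertices are collected in a list, with repetition.\<close>

fun vertices :: "ptree \<Rightarrow> ptree list" where
  "vertices (Node ts) = Node ts # concat (map vertices ts)"

definition fertility :: "ptree \<Rightarrow> nat" where
  "fertility s = length (children s)"

definition weight :: "ptree \<Rightarrow> nat" where
  "weight t = length (vertices t)"

definition forest_weight :: "pforest \<Rightarrow> nat" where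
  "forest_weight w = (\<Sum>t\<leftarrow>w. weight t)"

definition ladder :: "ptree \<Rightarrow> bool" where
  "ladder t \<longleftrightarrow> (\<forall>s\<in>set (vertices t). fertility s \<le> 1)"

lemma weight_Node: "weight (Node ts) = Suc (forest_weight ts)"
  by (simp add: weight_def forest_weight_def length_concat comp_def)

lemma finite_forests: "finite {w. forest_weight w = n}"
proof (induction n rule: less_induct)
  case (less n)
  show ?case
  proof (cases n)
    case 0
    have "{w. forest_weight w = 0} \<subseteq> {[]}"
    proof
      fix w assume "w \<in> {w. forest_weight w = 0}"
      then show "w \<in> {[]}"
        by (cases w; cases "hd w") (auto simp: forest_weight_def weight_def)
    qed
    then show ?thesis using 0 finite_subset by blast
  next
    case (Suc m)
    let ?F = "\<Union>k\<in>{..<n}. {w. forest_weight w = k}"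
    have "{w. forest_weight w = n} \<subseteq> (\<lambda>(u, v). Node u # v) ` (?F \<times> ?F)"
    proof
      fix w assume w: "w \<in> {w. forest_weight w = n}"
      then obtain t v where tv: "w = t # v"
        using Suc by (cases w) (auto simp: forest_weight_def)
      obtain u where u: "t = Node u" by (cases t)
      have "forest_weight w = Suc (forest_weight u + forest_weight v)"
        using tv u weight_Node[of u] by (simp add: forest_weight_def)
      then have "u \<in> ?F" "v \<in> ?F" using w by auto
      then show "w \<in> (\<lambda>(u, v). Node u # v) ` (?F \<times> ?F)" using tv u by force
    qed
    moreover have "finite ?F" using less by auto
    ultimately show ?thesis by (meson finite_SigmaI finite_imageI finite_subset)
  qed
qed


section \<open>The completion of the free algebra on planar rooted trees\<close>

text \<open>Planar forests, i.e. words in planar trees, form the monomial basis of the free algebra. There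
  are finitely many forests of each weight (lemma \<open>finite_forests\<close>), so an element of the product
  of the homogeneous components is an arbitrary family of coefficients indexed by forests.\<close>

typedef 'a nck_completion = "UNIV :: (pforest \<Rightarrow> 'a) set"
  morphisms coeff Series
  by simp

setup_lifting type_definition_nck_completion

lemma nck_eqI: "(\<And>w. coeff f w = coeff g w) \<Longrightarrow> f = g"
  by (simp add: coeff_inject[symmetric] ext)

lemma sum_splits_assoc:
  fixes f g h :: "'b list \<Rightarrow> 'a::semiring_0"
  shows "(\<Sum>i\<le>length w. (\<Sum>j\<le>length (take i w). f (take j (take i w)) * g (drop j (take i w)))
            * h (drop i w)) =
         (\<Sum>i\<le>length w. f (take i w) *
            (\<Sum>k\<le>length (drop i w). g (take k (drop i w)) * h (drop k (drop i w))))"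
proof -
  let ?n = "length w"
  have "(\<Sum>i\<le>?n. (\<Sum>j\<le>length (take i w). f (take j (take i w)) * g (drop j (take i w)))
            * h (drop i w)) =
        (\<Sum>i\<le>?n. \<Sum>j\<le>i. f (take j w) * g (drop j (take i w)) * h (drop i w))"
    by (rule sum.cong) (auto simp: sum_distrib_right min_def intro!: sum.cong)
  also have "\<dots> = (\<Sum>(i, j)\<in>Sigma {..?n} (\<lambda>i. {..i}).
                     f (take j w) * g (drop j (take i w)) * h (drop i w))"
    by (simp add: sum.Sigma)
  also have "\<dots> = (\<Sum>(i, k)\<in>Sigma {..?n} (\<lambda>i. {..?n - i}).
                     f (take i w) * (g (take k (drop i w)) * h (drop k (drop i w))))"
    by (rule sum.reindex_bij_witness[of _ "\<lambda>(i, k). (i + k, i)" "\<lambda>(i, j). (j, i - j)"])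
       (auto simp: take_drop mult.assoc add.commute)
  also have "\<dots> = (\<Sum>i\<le>?n. f (take i w) *
            (\<Sum>k\<le>length (drop i w). g (take k (drop i w)) * h (drop k (drop i w))))"
    by (simp add: sum.Sigma[symmetric] sum_distrib_left)
  finally show ?thesis .
qed

instantiation nck_completion :: (ring_1) ring_1
begin

lift_definition zero_nck_completion :: "'a nck_completion" is "\<lambda>_. 0" .

lift_definition one_nck_completion :: "'a nck_completion" is "\<lambda>w. if w = [] then 1 else 0" .

lift_definition plus_nck_completion ::
  "'a nck_completion \<Rightarrow> 'a nck_completion \<Rightarrow> 'a nck_completion" is "\<lambda>f g w. f w + g w" .

lift_definition minus_nck_completion ::
  "'a nck_completion \<Rightarrow> 'a nck_completion \<Rightarrow> 'a nck_completion" is "\<lambda>f g w. f w - g w" .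

lift_definition uminus_nck_completion ::
  "'a nck_completion \<Rightarrow> 'a nck_completion" is "\<lambda>f w. - f w" .

lift_definition times_nck_completion ::
  "'a nck_completion \<Rightarrow> 'a nck_completion \<Rightarrow> 'a nck_completion" is
  "\<lambda>f g w. \<Sum>i\<le>length w. f (take i w) * g (drop i w)" .

instance
proof
  fix a b c :: "'a nck_completion"
  show "a * b * c = a * (b * c)"
    by transfer (rule ext, rule sum_splits_assoc)
  show "1 * a = a"
  proof (rule nck_eqI)
    fix w
    have "coeff (1 * a) w = (\<Sum>i\<le>length w. if i = 0 then coeff a w else 0)"
      unfolding times_nck_completion.rep_eq one_nck_completion.rep_eq
      by (rule sum.cong) auto
    then show "coeff (1 * a) w = coeff a w" by simp
  qed
  show "a * 1 = a"
  proof (rule nck_eqI)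
    fix w
    have "coeff (a * 1) w = (\<Sum>i\<le>length w. if i = length w then coeff a w else 0)"
      unfolding times_nck_completion.rep_eq one_nck_completion.rep_eq
      by (rule sum.cong) auto
    then show "coeff (a * 1) w = coeff a w" by simp
  qed
  show "(a + b) * c = a * c + b * c" "a * (b + c) = a * b + a * c"
    by (transfer; simp add: algebra_simps sum.distrib fun_eq_iff)+
  show "(0::'a nck_completion) \<noteq> 1"
    by transfer (auto simp: fun_eq_iff)
qed (transfer; simp add: algebra_simps fun_eq_iff)+

end

definition monomial :: "pforest \<Rightarrow> 'a::ring_1 nck_completion" where
  "monomial u = Series (\<lambda>w. if w = u then 1 else 0)"

lemma coeff_monomial: "coeff (monomial u) w = (if w = u then 1 else 0)"
  by (simp add: monomial_def Series_inverse)

lemma monomial_Nil: "monomial [] = 1"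
  by (rule nck_eqI) (simp add: coeff_monomial one_nck_completion.rep_eq)

lemma monomial_append: "monomial u * monomial v = (monomial (u @ v) :: 'a::ring_1 nck_completion)"
proof (rule nck_eqI)
  fix w
  have splits: "take i w = u \<and> drop i w = v \<longleftrightarrow> i = length u \<and> w = u @ v" if "i \<le> length w" for i
    using that by (metis append_eq_conv_conj append_take_drop_id length_take min.absorb2)
  have "coeff (monomial u * monomial v :: 'a nck_completion) w =
        (\<Sum>i\<le>length w. if take i w = u \<and> drop i w = v then 1 else 0)"
    unfolding times_nck_completion.rep_eq coeff_monomial by (rule sum.cong) simp_all
  also have "\<dots> = (\<Sum>i\<le>length w. if i = length u then if w = u @ v then 1 else 0 else 0)"
    by (rule sum.cong[OF refl]) (simp add: splits)
  finally show "coeff (monomial u * monomial v :: 'a nck_completion) w = coeff (monomial (u @ v)) w"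
    by (simp add: coeff_monomial)
qed

definition homogeneous_component :: "nat \<Rightarrow> 'a::zero nck_completion \<Rightarrow> 'a nck_completion" where
  "homogeneous_component n f = Series (\<lambda>w. if forest_weight w = n then coeff f w else 0)"

text \<open>The continuous linear extension of \<open>u \<mapsto> Node u\<close>, see lemma \<open>B_plus_monomial\<close>.\<close>

definition B_plus :: "'a::zero nck_completion \<Rightarrow> 'a nck_completion" where
  "B_plus f = Series (\<lambda>w. case w of [Node u] \<Rightarrow> coeff f u | _ \<Rightarrow> 0)"

lemma coeff_B_plus: "coeff (B_plus f) w = (case w of [Node u] \<Rightarrow> coeff f u | _ \<Rightarrow> 0)"
  by (simp add: B_plus_def Series_inverse)

lemma B_plus_monomial: "B_plus (monomial u) = monomial [Node u]"
  by (rule nck_eqI) (auto simp: coeff_B_plus coeff_monomial split: list.splits ptree.splits)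

text \<open>\<open>P(X) = \<Sum>n. p\<^sub>n X\<^sup>n\<close>, for \<open>X\<close> without constant term. Each coefficient is then a finite sum
  by lemma \<open>finite_coeff_power\<close>.\<close>

definition fps_subst :: "'a::ring_1 fps \<Rightarrow> 'a nck_completion \<Rightarrow> 'a nck_completion" where
  "fps_subst P X = Series (\<lambda>w. Sum_any (\<lambda>n. fps_nth P n * coeff (X ^ n) w))"

lemma coeff_power_eq_0:
  "coeff X [] = 0 \<Longrightarrow> length w < n \<Longrightarrow> coeff (X ^ n) w = 0"
proof (induction n arbitrary: w)
  case (Suc n)
  have "coeff X (take i w) * coeff (X ^ n) (drop i w) = 0" if "i \<le> length w" for i
    using Suc that by (cases "i = 0") auto
  then show ?case by (simp add: times_nck_completion.rep_eq)
qed simp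

lemma finite_coeff_power:
  "coeff X [] = 0 \<Longrightarrow> finite {n. fps_nth P n * coeff (X ^ n) w \<noteq> 0}"
proof (rule finite_subset[of _ "{..length w}"])
  assume "coeff X [] = 0"
  then have "coeff (X ^ n) w = 0" if "\<not> n \<le> length w" for n
    using that coeff_power_eq_0[of X w n] by simp
  then show "{n. fps_nth P n * coeff (X ^ n) w \<noteq> 0} \<subseteq> {..length w}"
    using mult_zero_right by fastforce
qed simp


section \<open>The Dyson--Schwinger equation\<close>

definition is_P :: "'a::field_char_0 \<Rightarrow> 'a \<Rightarrow> 'a fps \<Rightarrow> bool" where
  "is_P \<alpha> \<beta> P \<longleftrightarrow>
     (1 - fps_const (\<alpha> * \<beta>) * fps_X) * fps_deriv P = fps_const \<alpha> * P \<and> fps_nth P 0 = 1"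

definition P_series :: "'a::field_char_0 \<Rightarrow> 'a \<Rightarrow> 'a fps" where
  "P_series \<alpha> \<beta> = (THE P. is_P \<alpha> \<beta> P)"

definition X_series :: "'a::field_char_0 \<Rightarrow> 'a \<Rightarrow> 'a nck_completion" where
  "X_series \<alpha> \<beta> = (THE X. X = B_plus (fps_subst (P_series \<alpha> \<beta>) X))"

definition a_hom :: "nat \<Rightarrow> 'a::field_char_0 \<Rightarrow> 'a \<Rightarrow> 'a nck_completion" where
  "a_hom n \<alpha> \<beta> = homogeneous_component n (X_series \<alpha> \<beta>)"

definition a_coeff :: "ptree \<Rightarrow> 'a::field_char_0 \<Rightarrow> 'a \<Rightarrow> 'a" where
  "a_coeff t \<alpha> \<beta> = coeff (a_hom (weight t) \<alpha> \<beta>) [t]"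

lemma is_P_iff:
  "is_P \<alpha> \<beta> P \<longleftrightarrow>
     fps_nth P 0 = 1 \<and>
     (\<forall>n. of_nat (Suc n) * fps_nth P (Suc n) = \<alpha> * (1 + \<beta> * of_nat n) * fps_nth P n)"
proof -
  have "fps_nth ((1 - fps_const (\<alpha> * \<beta>) * fps_X) * fps_deriv P) n = fps_nth (fps_const \<alpha> * P) n
        \<longleftrightarrow> of_nat (Suc n) * fps_nth P (Suc n) = \<alpha> * (1 + \<beta> * of_nat n) * fps_nth P n" for n
    by (cases n) (auto simp: algebra_simps)
  then show ?thesis unfolding is_P_def fps_eq_iff by blast
qed

lemma ex1_P: "\<exists>!P. is_P \<alpha> \<beta> P"
proof (rule ex_ex1I)
  define p where "p = rec_nat 1 (\<lambda>n x. \<alpha> * (1 + \<beta> * of_nat n) * x / of_nat (Suc n))"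
  have "is_P \<alpha> \<beta> (Abs_fps p)"
    unfolding is_P_iff by (auto simp: p_def simp del: of_nat_Suc)
  then show "\<exists>P. is_P \<alpha> \<beta> P" ..
next
  fix P Q assume P: "is_P \<alpha> \<beta> P" and Q: "is_P \<alpha> \<beta> Q"
  have "fps_nth P n = fps_nth Q n" for n
  proof (induction n)
    case (Suc n)
    have "of_nat (Suc n) * fps_nth P (Suc n) = of_nat (Suc n) * fps_nth Q (Suc n)"
      using P Q Suc unfolding is_P_iff by metis
    then show ?case by (metis mult_left_cancel of_nat_neq_0)
  qed (use P Q in \<open>simp add: is_P_iff\<close>)
  then show "P = Q" by (simp add: fps_eq_iff)
qed

lemma coeff_power_trees:
  assumes "\<And>w. length w \<noteq> 1 \<Longrightarrow> coeff X w = 0"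
  shows "coeff (X ^ n) w = (if n = length w then \<Prod>t\<leftarrow>w. coeff X [t] else 0)"
proof (induction n arbitrary: w)
  case 0
  then show ?case by (auto simp: one_nck_completion.rep_eq)
next
  case (Suc n)
  show ?case
  proof (cases w)
    case Nil
    then show ?thesis using assms[of "[]"] by (simp add: times_nck_completion.rep_eq)
  next
    case (Cons t v)
    have "coeff (X ^ Suc n) w = (\<Sum>i\<le>length w. coeff X (take i w) * coeff (X ^ n) (drop i w))"
      by (simp add: times_nck_completion.rep_eq)
    also have "\<dots> = (\<Sum>i\<le>length w. if i = 1 then coeff X [t] * coeff (X ^ n) v else 0)"
      by (rule sum.cong) (auto simp: Cons assms min_def)
    also have "\<dots> = coeff X [t] * coeff (X ^ n) v" using Cons by (subst sum.delta) auto
    finally show ?thesis using Cons Suc by auto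
  qed
qed

lemma coeff_fps_subst_trees:
  assumes "\<And>w. length w \<noteq> 1 \<Longrightarrow> coeff X w = 0"
  shows "coeff (fps_subst P X) w = fps_nth P (length w) * (\<Prod>t\<leftarrow>w. coeff X [t])"
proof -
  have "(\<lambda>n. fps_nth P n * coeff (X ^ n) w) =
        (\<lambda>n. if n = length w then fps_nth P (length w) * (\<Prod>t\<leftarrow>w. coeff X [t]) else 0)"
    (is "_ = ?g") by (auto simp: coeff_power_trees[OF assms])
  then have "coeff (fps_subst P X) w = Sum_any ?g"
    by (simp only: fps_subst_def Series_inverse[OF UNIV_I])
  also have "\<dots> = sum ?g {length w}"
    by (rule Sum_any.expand_superset) auto
  finally show ?thesis by simp
qed

lemma DSE_iff:
  "X = B_plus (fps_subst P X) \<longleftrightarrow>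
     (\<forall>w. length w \<noteq> 1 \<longrightarrow> coeff X w = 0) \<and>
     (\<forall>ts. coeff X [Node ts] = fps_nth P (length ts) * (\<Prod>t\<leftarrow>ts. coeff X [t]))"
  (is "?L \<longleftrightarrow> ?R")
proof
  assume L: ?L
  have 1: "coeff X w = 0" if "length w \<noteq> 1" for w
    by (subst L) (use that in \<open>auto simp: coeff_B_plus split: list.splits ptree.splits\<close>)
  have "coeff X [Node ts] = coeff (fps_subst P X) ts" for ts
    by (subst L) (simp add: coeff_B_plus)
  then show ?R using 1 coeff_fps_subst_trees[OF 1] by simp
next
  assume R: ?R
  then have "coeff (fps_subst P X) w = fps_nth P (length w) * (\<Prod>t\<leftarrow>w. coeff X [t])" for w
    by (intro coeff_fps_subst_trees) auto
  then show ?L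
    using R by (intro nck_eqI) (auto simp: coeff_B_plus split: list.splits ptree.splits)
qed

primrec tree_solution :: "'a::comm_ring_1 fps \<Rightarrow> ptree \<Rightarrow> 'a" where
  "tree_solution P (Node ts) = fps_nth P (length ts) * prod_list (map (tree_solution P) ts)"

lemma ex1_X: "\<exists>!X. X = B_plus (fps_subst P X)" for P :: "'a::comm_ring_1 fps"
proof (rule ex_ex1I)
  have "Series (\<lambda>w. case w of [t] \<Rightarrow> tree_solution P t | _ \<Rightarrow> 0) =
        B_plus (fps_subst P (Series (\<lambda>w. case w of [t] \<Rightarrow> tree_solution P t | _ \<Rightarrow> 0)))"
    unfolding DSE_iff by (auto simp: Series_inverse split: list.splits)
  then show "\<exists>X. X = B_plus (fps_subst P X)" by blast
next
  fix X Y assume X: "X = B_plus (fps_subst P X)" and Y: "Y = B_plus (fps_subst P Y)"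
  have trees: "coeff X [t] = coeff Y [t]" for t
  proof (induction t)
    case (Node ts)
    then have "map (\<lambda>t. coeff X [t]) ts = map (\<lambda>t. coeff Y [t]) ts" by simp
    moreover have "coeff Z [Node ts] = fps_nth P (length ts) * prod_list (map (\<lambda>t. coeff Z [t]) ts)"
      if "Z = B_plus (fps_subst P Z)" for Z
      using that unfolding DSE_iff by blast
    ultimately show ?case using X Y by metis
  qed
  show "X = Y"
  proof (rule nck_eqI)
    fix w
    show "coeff X w = coeff Y w"
    proof (cases "length w = 1")
      case True
      then obtain t where "w = [t]" by (auto simp: length_Suc_conv)
      then show ?thesis using trees by simp
    next
      case False
      then show ?thesis using X[unfolded DSE_iff] Y[unfolded DSE_iff] by simp
    qed
  qed
qed


section \<open>Tree factorials\<close>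

definition bracket :: "'a::comm_ring_1 \<Rightarrow> nat \<Rightarrow> 'a" where
  "bracket \<beta> i = 1 + \<beta> * (of_nat i - 1)"

definition bracket_fact :: "'a::comm_ring_1 \<Rightarrow> nat \<Rightarrow> 'a" where
  "bracket_fact \<beta> n = (\<Prod>i=1..n. bracket \<beta> i)"

definition tree_fact :: "ptree \<Rightarrow> nat" where
  "tree_fact t = (\<Prod>s\<leftarrow>vertices t. fact (fertility s))"

definition tree_bracket_fact :: "'a::comm_ring_1 \<Rightarrow> ptree \<Rightarrow> 'a" where
  "tree_bracket_fact \<beta> t = (\<Prod>s\<leftarrow>vertices t. bracket_fact \<beta> (fertility s))"

end

theory Submission
  imports Defs
begin

text \<open>
  Since \<open>B_plus\<close> produces only single trees, comparing coefficients in the Dyson--Schwinger equation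
  at \<open>Node ts\<close> gives a recursion in which the root contributes the factor \<open>p\<^sub>k\<close>, with \<open>k\<close> its
  fertility, and the children contribute their own coefficients. Unfolding the recursion, the
  coefficient of a tree is the product of \<open>p\<^sub>k\<close> over all its vertices (\<open>a_coeff_eq_prod_vertices\<close>).

  The differential equation for \<open>P\<close> is the recurrence
  \<open>(n + 1) p\<^sub>n\<^sub>+\<^sub>1 = \<alpha> [n + 1]\<^sub>\<beta> p\<^sub>n\<close>, so \<open>p\<^sub>n = \<alpha>\<^sup>n [n]\<^sub>\<beta>! / n!\<close> (\<open>P_series_nth\<close>). In the product over
  the vertices, the brackets and the factorials give the two tree factorials, while \<open>\<alpha>\<close> is raised to
  the sum of the fertilities. That sum is \<open>|t| - 1\<close>, because every vertex except the root is a child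
  of exactly one vertex (\<open>sum_fertility\<close>).

  The special values follow by evaluating \<open>[n]\<^sub>\<beta>!\<close>: it is \<open>1\<close> for \<open>\<beta> = 0\<close> and \<open>n!\<close> for \<open>\<beta> = 1\<close>; for
  \<open>\<beta> = -1\<close> the factor \<open>[2]\<^sub>\<beta> = 0\<close> kills it as soon as \<open>n \<ge> 2\<close>, so only ladders survive,
  and for them both tree factorials are \<open>1\<close>. At \<open>\<alpha> = 0\<close> the power \<open>\<alpha>\<^bsup>|t| - 1\<^esup>\<close> vanishes unless
  \<open>|t| = 1\<close>, where it is \<open>0\<^sup>0 = 1\<close>.
\<close>

lemma bracket_fact_0 [simp]: "bracket_fact \<beta> 0 = 1"
  by (simp add: bracket_fact_def)

lemma bracket_fact_Suc: "bracket_fact \<beta> (Suc n) = (1 + \<beta> * of_nat n) * bracket_fact \<beta> n"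
  by (simp add: bracket_fact_def bracket_def mult.commute)

lemma P_series_nth: "fps_nth (P_series \<alpha> \<beta>) n = \<alpha> ^ n * (bracket_fact \<beta> n / fact n)"
proof (induction n)
  case 0
  show ?case
    using theI'[OF ex1_P[of \<alpha> \<beta>]] by (simp add: P_series_def is_P_iff)
next
  case (Suc n)
  have "of_nat (Suc n) * fps_nth (P_series \<alpha> \<beta>) (Suc n) =
        \<alpha> * (1 + \<beta> * of_nat n) * fps_nth (P_series \<alpha> \<beta>) n"
    using theI'[OF ex1_P[of \<alpha> \<beta>]] by (simp add: P_series_def is_P_iff)
  then have "fps_nth (P_series \<alpha> \<beta>) (Suc n) =
        \<alpha> * (1 + \<beta> * of_nat n) * fps_nth (P_series \<alpha> \<beta>) n / of_nat (Suc n)"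
    by (metis nonzero_mult_div_cancel_left of_nat_neq_0)
  then show ?case
    by (simp add: Suc bracket_fact_Suc mult_ac)
qed

lemma a_coeff_eq_coeff_X_series: "a_coeff t \<alpha> \<beta> = coeff (X_series \<alpha> \<beta>) [t]"
  by (simp add: a_coeff_def a_hom_def homogeneous_component_def Series_inverse forest_weight_def)

lemma a_coeff_Node:
  "a_coeff (Node ts) \<alpha> \<beta> =
     fps_nth (P_series \<alpha> \<beta>) (length ts) * (\<Prod>t\<leftarrow>ts. a_coeff t \<alpha> \<beta>)"
proof -
  have "X_series \<alpha> \<beta> = B_plus (fps_subst (P_series \<alpha> \<beta>) (X_series \<alpha> \<beta>))"
    unfolding X_series_def by (rule theI'[OF ex1_X])
  then show ?thesis
    unfolding DSE_iff a_coeff_eq_coeff_X_series by blast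
qed

lemma prod_list_concat_map:
  fixes f :: "'b \<Rightarrow> 'c::comm_monoid_mult"
  shows "prod_list (map f (concat xss)) = (\<Prod>xs\<leftarrow>xss. prod_list (map f xs))"
  by (induction xss) auto

lemma fertility_Node: "fertility (Node ts) = length ts"
  by (simp add: fertility_def)

lemma a_coeff_eq_prod_vertices:
  "a_coeff t \<alpha> \<beta> = (\<Prod>s\<leftarrow>vertices t. fps_nth (P_series \<alpha> \<beta>) (fertility s))"
proof (induction t)
  case (Node ts)
  then have "(\<Prod>t\<leftarrow>ts. a_coeff t \<alpha> \<beta>) =
      (\<Prod>t\<leftarrow>ts. \<Prod>s\<leftarrow>vertices t. fps_nth (P_series \<alpha> \<beta>) (fertility s))"
    by (simp cong: map_cong)
  then show ?case
    by (simp add: a_coeff_Node fertility_Node prod_list_concat_map comp_def)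
qed

text \<open>Every vertex other than the root is the child of exactly one vertex.\<close>

lemma Suc_sum_fertility: "Suc (\<Sum>s\<leftarrow>vertices t. fertility s) = weight t"
proof (induction t)
  case (Node ts)
  then have "length ts + (\<Sum>s\<leftarrow>concat (map vertices ts). fertility s) = forest_weight ts"
  proof (induction ts)
    case (Cons t ts)
    have "Suc (\<Sum>s\<leftarrow>vertices t. fertility s) = weight t"
      using Cons.prems by simp
    moreover have "length ts + (\<Sum>s\<leftarrow>concat (map vertices ts). fertility s) = forest_weight ts"
      using Cons by simp
    ultimately show ?case
      by (simp add: forest_weight_def)
  qed (simp add: forest_weight_def)
  then show ?case
    by (simp add: weight_Node fertility_Node)
qed

corollary sum_fertility: "(\<Sum>s\<leftarrow>vertices t. fertility s) = weight t - 1"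
  using Suc_sum_fertility[of t] by linarith

lemma prod_list_P_coefficients:
  fixes \<alpha> \<beta> :: "'a::field_char_0"
  shows "(\<Prod>s\<leftarrow>ss. \<alpha> ^ f s * (bracket_fact \<beta> (f s) / fact (f s))) =
    \<alpha> ^ (\<Sum>s\<leftarrow>ss. f s) *
      ((\<Prod>s\<leftarrow>ss. bracket_fact \<beta> (f s)) / of_nat (\<Prod>s\<leftarrow>ss. fact (f s)))"
  by (induction ss) (simp_all add: power_add)

lemma a_coeff_formula:
  "a_coeff t \<alpha> \<beta> = \<alpha> ^ (weight t - 1) * (tree_bracket_fact \<beta> t / of_nat (tree_fact t))"
  unfolding a_coeff_eq_prod_vertices P_series_nth prod_list_P_coefficients sum_fertility
    tree_bracket_fact_def tree_fact_def ..

lemma tree_fact_nonzero: "tree_fact t \<noteq> 0"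
  by (auto simp: tree_fact_def prod_list_zero_iff)

lemma bracket_fact_at_0: "bracket_fact 0 n = 1"
  by (simp add: bracket_fact_def bracket_def)

lemma bracket_fact_at_1: "bracket_fact 1 n = fact n"
  by (induction n) (simp_all add: bracket_fact_Suc)

lemma bracket_fact_at_minus_1: "bracket_fact (-1) n = (if n \<le> 1 then 1 else 0)"
proof (induction n)
  case (Suc n)
  consider "n = 0" | "n = 1" | "n > 1" by linarith
  then show ?case
    by cases (simp_all add: Suc bracket_fact_Suc)
qed simp

lemma tree_bracket_fact_at_0: "tree_bracket_fact 0 t = 1"
  by (simp add: tree_bracket_fact_def bracket_fact_at_0 map_replicate_const)

lemma tree_bracket_fact_at_1:
  "tree_bracket_fact 1 t = (of_nat (tree_fact t) :: 'a::{comm_ring_1, semiring_char_0})"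
proof -
  have "(\<Prod>s\<leftarrow>ss. fact (fertility s)) = (of_nat (\<Prod>s\<leftarrow>ss. fact (fertility s)) :: 'a)"
    for ss
    by (induction ss) simp_all
  then show ?thesis
    by (simp add: tree_bracket_fact_def tree_fact_def bracket_fact_at_1)
qed

lemma tree_bracket_fact_at_minus_1:
  "tree_bracket_fact (-1) t = (if ladder t then 1 else 0 :: 'a::comm_ring_1)"
proof -
  have "(\<Prod>s\<leftarrow>ss. bracket_fact (-1) (fertility s)) =
      (if \<forall>s\<in>set ss. fertility s \<le> 1 then 1 else 0 :: 'a)" for ss
    by (induction ss) (auto simp: bracket_fact_at_minus_1)
  then show ?thesis
    by (simp add: tree_bracket_fact_def ladder_def)
qed

lemma tree_fact_ladder: "ladder t \<Longrightarrow> tree_fact t = 1"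
proof -
  have "(\<Prod>s\<leftarrow>ss. fact (fertility s)) = (1::nat)" if "\<forall>s\<in>set ss. fertility s \<le> 1" for ss
    using that by (induction ss) (auto simp: le_Suc_eq)
  then show "ladder t \<Longrightarrow> tree_fact t = 1"
    by (simp add: tree_fact_def ladder_def)
qed

lemma weight_minus_1_eq_0_iff: "weight t - 1 = 0 \<longleftrightarrow> t = \<bullet>\<^sub>T"
proof (cases t)
  case (Node ts)
  show ?thesis
    by (cases ts; cases "hd ts") (auto simp: Node weight_Node forest_weight_def)
qed

lemma a_coeff_at_alpha_0: "a_coeff t 0 \<beta> = (if t = \<bullet>\<^sub>T then 1 else 0)"
proof (cases "t = \<bullet>\<^sub>T")
  case True
  then show ?thesis
    by (simp add: a_coeff_Node P_series_nth)
next
  case False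
  then have "weight t - 1 > 0"
    using weight_minus_1_eq_0_iff[of t] by simp
  then show ?thesis
    using False by (simp add: a_coeff_formula)
qed

theorem theorem11:
  fixes \<alpha> \<beta> :: "'a::field_char_0"
  shows "(\<forall>t. a_coeff t \<alpha> \<beta> =
              \<alpha> ^ (weight t - 1) * (tree_bracket_fact \<beta> t / of_nat (tree_fact t))) \<and>
         (\<forall>t. a_coeff t (1::'a) 0 = 1 / of_nat (tree_fact t)) \<and>
         (\<forall>t. a_coeff t (1::'a) 1 = 1) \<and>
         (\<forall>t. a_coeff t 0 \<beta> = (if t = \<bullet>\<^sub>T then 1 else 0)) \<and>
         (\<forall>t. ladder t \<longrightarrow> a_coeff t (1::'a) (-1) = 1) \<and>
         (\<forall>t. \<not> ladder t \<longrightarrow> a_coeff t (1::'a) (-1) = 0)"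
  by (simp add: a_coeff_at_alpha_0)
    (simp add: a_coeff_formula tree_bracket_fact_at_0 tree_bracket_fact_at_1
      tree_bracket_fact_at_minus_1 tree_fact_ladder tree_fact_nonzero)

end
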